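(* Let $\lambda$ be a partition whose Young diagram is a rectangle, and let $\eta\in\mathcal{A}^+$. Then there is a bijection $\gamma:\mathcal{T}(\lambda)\to\mathcal{T}(\lambda)$ such that for every $\sigma\in\mathcal{T}(\lambda)$: $\gamma(\sigma)$ is row-equivalent to $\sigma$; $\mathrm{maj}(\gamma(\sigma))=\mathrm{maj}(\sigma)$ and $\eta(\gamma(\sigma))=\mathrm{quinv}(\sigma)$; the top rows of $\gamma(\sigma)$ and $\sigma$ are identical; and for every $r$, the number of columns $c$ with $\gamma(\sigma)(r+1,c)>\gamma(\sigma)(r,c)$ equals the number of columns $c$ with $\sigma(r+1,c)>\sigma(r,c)$.
   Context: French Young diagram of $\lambda$ with cells $(r,c)$ (row $r$ from the bottom, column $c$ from the left), $\lambda'_c$ = height of column $c$. $\mathcal{T}(\lambda)$ = fillings by positive integers; convention $\sigma(\lambda'_c+1,c)=0$. Row-equivalent: same multiset of entries in each row. A cell $(r,c)$, $2\le r\le\lambda'_c$, is a descent if $\sigma(r,c)>\sigma(r-1,c)$; $\mathrm{maj}(\sigma)=\sum_{\text{descents}}(\lambda'_c-r+1)$. $Q(a,b,c)=1$ iff $a<b<c$ or $b<c<a$ or $c<a<b$ or $a=b\ne c$, else $0$. $\mathrm{quinv}(\sigma)$ = number of triples of cells $((r+1,c),(r,c),(r,d))$ with $c<d$, $1\le r\le\lambda'_d$, $Q(\sigma(r+1,c),\sigma(r,c),\sigma(r,d))=1$. Pattern sets: $S^*$ = chains $z=w>v>u$, $u\ge z=w>v$, $v>u\ge z=w$; each $S_i$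 consists of $S^*$, the chains $z>v\ge w>u$, $u\ge z>v\ge w$ and: $S_1$: $z>w>v>u$, $u>v\ge z>w$, $z>u>v\ge w$, $v\ge z>w>u$; $S_2$: $z>w>v>u$, $v>u\ge z>w$, $z>u>v\ge w$, $v\ge z>w>u$; $S_3$: $z>w>u>v$, $u>v\ge z>w$, $z>u>v\ge w$, $v\ge z>w>u$; $S_4$: $z>w>u>v$, $v>u\ge z>w$, $z>u>v\ge w$, $v\ge z>w>u$; $S_5$: $z>w>v>u$, $u>v\ge z>w$, $z>v>u\ge w$, $u\ge z>w>v$; $S_6$: $z>w>u>v$, $u>v\ge z>w$, $z>v>u\ge w$, $u\ge z>w>v$; $S_7$: $z>w>v>u$, $v>u\ge z>w$, $z>v>u\ge w$, $u\ge z>w>v$; $S_8$: $z>w>u>v$, $v>u\ge z>w$, $z>v>u\ge w$, $u\ge z>w>v$. $Q_S(z,w,u,v)=1$ iff $(z,w,u,v)$ satisfies a chain of $S^*$, or one of the six further chains of $S$, or $(w,z,v,u)$ satisfies one of those six chains. $\eta_S(\sigma)$ = number of 4-tuples of cells $(r+1,c),(r+1,d),(r,c),(r,d)$ with $c<d$, $\lambda'_c=\lambda'_d$, $1\le r\le\lambda'_c$, $Q_S(\sigma(r+1,c),\sigma(r+1,d),\sigma(r,c),\sigma(r,d))=1$. $\eta^{(S)}(\sigma)=\eta_S(\sigma)+$ number of triples counted by $\mathrm{quinv}$ with $\lambda'_d<\lambda'_c$ (for a rectangle, $\eta^{(S)}=\eta_S$). $\mathcal{A}^+=\{\eta^{(S_1)},\dots,\eta^{(S_8)}\}$.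 *)

theory Defs
  imports Main "HOL-Library.Multiset"
begin

text \<open>A partition is the list of its parts, and a cell is a pair \<open>(r, c)\<close> with rows counted
  from the bottom and columns from the left, both starting at 1 (French convention).\<close>

definition is_partition :: "nat list \<Rightarrow> bool" where
  "is_partition lam \<longleftrightarrow> sorted_wrt (\<ge>) lam \<and> (\<forall>p \<in> set lam. 0 < p)"

definition diagram :: "nat list \<Rightarrow> (nat \<times> nat) set" where
  "diagram lam = {(r, c). 1 \<le> r \<and> r \<le> length lam \<and> 1 \<le> c \<and> c \<le> lam ! (r - 1)}"

definition col_height :: "nat list \<Rightarrow> nat \<Rightarrow> nat" where
  "col_height lam c = card {r. (r, c) \<in> diagram lam}"

definition columns :: "nat list \<Rightarrow> nat set" where
  "columns lam = {c. \<exists>r. (r, c) \<in> diagram lam}"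

definition is_rectangle :: "nat list \<Rightarrow> bool" where
  "is_rectangle lam \<longleftrightarrow> (\<exists>m n. diagram lam = {1..m} \<times> {1..n})"

text \<open>Fillings are extended by 0 outside the diagram.  This makes each filling a unique function
  and builds in the convention that the entry just above the top of every column is 0.\<close>

type_synonym filling = "nat \<Rightarrow> nat \<Rightarrow> nat"

definition fillings :: "nat list \<Rightarrow> filling set" where
  "fillings lam =
     {\<sigma>. (\<forall>r c. (r, c) \<in> diagram lam \<longrightarrow> 0 < \<sigma> r c) \<and>
         (\<forall>r c. (r, c) \<notin> diagram lam \<longrightarrow> \<sigma> r c = 0)}"

definition row_entries :: "nat list \<Rightarrow> filling \<Rightarrow> nat \<Rightarrow> nat multiset" where
  "row_entries lam \<sigma> r = image_mset (\<sigma> r) (mset_set {c. (r, c) \<in> diagram lam})"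

definition row_equivalent :: "nat list \<Rightarrow> filling \<Rightarrow> filling \<Rightarrow> bool" where
  "row_equivalent lam \<sigma> \<tau> \<longleftrightarrow>
     (\<forall>r \<in> {1..length lam}. row_entries lam \<sigma> r = row_entries lam \<tau> r)"

definition descents :: "nat list \<Rightarrow> filling \<Rightarrow> (nat \<times> nat) set" where
  "descents lam \<sigma> = {(r, c) \<in> diagram lam. 2 \<le> r \<and> \<sigma> (r - 1) c < \<sigma> r c}"

definition maj :: "nat list \<Rightarrow> filling \<Rightarrow> nat" where
  "maj lam \<sigma> = (\<Sum>(r, c) \<in> descents lam \<sigma>. col_height lam c - r + 1)"

definition Q :: "nat \<Rightarrow> nat \<Rightarrow> nat \<Rightarrow> bool" where
  "Q a b c \<longleftrightarrow> (a < b \<and> b < c) \<or> (b < c \<and> c < a) \<or> (c < a \<and> a < b) \<or> (a = b \<and> b \<noteq> c)"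

text \<open>The index \<open>(r, c, d)\<close> stands for the triple of cells \<open>((r+1, c), (r, c), (r, d))\<close>.\<close>

definition quinv_triples :: "nat list \<Rightarrow> filling \<Rightarrow> (nat \<times> nat \<times> nat) set" where
  "quinv_triples lam \<sigma> =
     {(r, c, d). 1 \<le> c \<and> c < d \<and> 1 \<le> r \<and> r \<le> col_height lam d \<and>
                 Q (\<sigma> (r + 1) c) (\<sigma> r c) (\<sigma> r d)}"

definition quinv :: "nat list \<Rightarrow> filling \<Rightarrow> nat" where
  "quinv lam \<sigma> = card (quinv_triples lam \<sigma>)"

text \<open>Patterns are predicates in the arguments \<open>z w u v\<close>, in this order.\<close>

type_synonym pattern = "nat \<Rightarrow> nat \<Rightarrow> nat \<Rightarrow> nat \<Rightarrow> bool"

definition S_star :: "pattern set" where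
  "S_star =
     {\<lambda>z w u v. z = w \<and> w > v \<and> v > u,
      \<lambda>z w u v. u \<ge> z \<and> z = w \<and> w > v,
      \<lambda>z w u v. v > u \<and> u \<ge> z \<and> z = w}"

definition S_common :: "pattern set" where
  "S_common =
     {\<lambda>z w u v. z > v \<and> v \<ge> w \<and> w > u,
      \<lambda>z w u v. u \<ge> z \<and> z > v \<and> v \<ge> w}"

text \<open>The sets \<open>S1\<close>, ..., \<open>S8\<close> list only the six chains of each pattern set outside \<open>S_star\<close>.
  The chains of \<open>S_star\<close> belong to every pattern set and are added in \<open>Q_S\<close>, since only
  the other six are also applied to the swapped arguments.\<close>

definition S1 :: "pattern set" where
  "S1 = S_common \<union>
     {\<lambda>z w u v. z > w \<and> w > v \<and> v > u,
      \<lambda>z w u v. u > v \<and> v \<ge> z \<and> z > w,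
      \<lambda>z w u v. z > u \<and> u > v \<and> v \<ge> w,
      \<lambda>z w u v. v \<ge> z \<and> z > w \<and> w > u}"

definition S2 :: "pattern set" where
  "S2 = S_common \<union>
     {\<lambda>z w u v. z > w \<and> w > v \<and> v > u,
      \<lambda>z w u v. v > u \<and> u \<ge> z \<and> z > w,
      \<lambda>z w u v. z > u \<and> u > v \<and> v \<ge> w,
      \<lambda>z w u v. v \<ge> z \<and> z > w \<and> w > u}"

definition S3 :: "pattern set" where
  "S3 = S_common \<union>
     {\<lambda>z w u v. z > w \<and> w > u \<and> u > v,
      \<lambda>z w u v. u > v \<and> v \<ge> z \<and> z > w,
      \<lambda>z w u v. z > u \<and> u > v \<and> v \<ge> w,
      \<lambda>z w u v. v \<ge> z \<and> z > w \<and> w > u}"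

definition S4 :: "pattern set" where
  "S4 = S_common \<union>
     {\<lambda>z w u v. z > w \<and> w > u \<and> u > v,
      \<lambda>z w u v. v > u \<and> u \<ge> z \<and> z > w,
      \<lambda>z w u v. z > u \<and> u > v \<and> v \<ge> w,
      \<lambda>z w u v. v \<ge> z \<and> z > w \<and> w > u}"

definition S5 :: "pattern set" where
  "S5 = S_common \<union>
     {\<lambda>z w u v. z > w \<and> w > v \<and> v > u,
      \<lambda>z w u v. u > v \<and> v \<ge> z \<and> z > w,
      \<lambda>z w u v. z > v \<and> v > u \<and> u \<ge> w,
      \<lambda>z w u v. u \<ge> z \<and> z > w \<and> w > v}"

definition S6 :: "pattern set" where
  "S6 = S_common \<union>
     {\<lambda>z w u v. z > w \<and> w > u \<and> u > v,
      \<lambda>z w u v. u > v \<and> v \<ge> z \<and> z > w,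
      \<lambda>z w u v. z > v \<and> v > u \<and> u \<ge> w,
      \<lambda>z w u v. u \<ge> z \<and> z > w \<and> w > v}"

definition S7 :: "pattern set" where
  "S7 = S_common \<union>
     {\<lambda>z w u v. z > w \<and> w > v \<and> v > u,
      \<lambda>z w u v. v > u \<and> u \<ge> z \<and> z > w,
      \<lambda>z w u v. z > v \<and> v > u \<and> u \<ge> w,
      \<lambda>z w u v. u \<ge> z \<and> z > w \<and> w > v}"

definition S8 :: "pattern set" where
  "S8 = S_common \<union>
     {\<lambda>z w u v. z > w \<and> w > u \<and> u > v,
      \<lambda>z w u v. v > u \<and> u \<ge> z \<and> z > w,
      \<lambda>z w u v. z > v \<and> v > u \<and> u \<ge> w,
      \<lambda>z w u v. u \<ge> z \<and> z > w \<and> w > v}"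

definition Q_S :: "pattern set \<Rightarrow> pattern" where
  "Q_S S z w u v \<longleftrightarrow>
     (\<exists>p \<in> S_star. p z w u v) \<or> (\<exists>p \<in> S. p z w u v) \<or> (\<exists>p \<in> S. p w z v u)"

text \<open>The index \<open>(r, c, d)\<close> stands for the cells \<open>(r+1, c), (r+1, d), (r, c), (r, d)\<close>.\<close>

definition eta_S :: "pattern set \<Rightarrow> nat list \<Rightarrow> filling \<Rightarrow> nat" where
  "eta_S S lam \<sigma> = card
     {(r, c, d). 1 \<le> c \<and> c < d \<and> col_height lam c = col_height lam d \<and>
                 1 \<le> r \<and> r \<le> col_height lam c \<and>
                 Q_S S (\<sigma> (r + 1) c) (\<sigma> (r + 1) d) (\<sigma> r c) (\<sigma> r d)}"

definition eta :: "pattern set \<Rightarrow> nat list \<Rightarrow> filling \<Rightarrow> nat" where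
  "eta S lam \<sigma> = eta_S S lam \<sigma> +
     card {(r, c, d) \<in> quinv_triples lam \<sigma>. col_height lam d < col_height lam c}"

definition A_plus :: "(nat list \<Rightarrow> filling \<Rightarrow> nat) set" where
  "A_plus = {eta S1, eta S2, eta S3, eta S4, eta S5, eta S6, eta S7, eta S8}"

end

theory Submission
  imports Defs "HOL-Combinatorics.Permutations"
begin

text \<open>All statistics are sums over pairs of adjacent rows, so it suffices to treat one row \<open>b\<close> below
  a row \<open>w\<close> and to match the joint distributions of descents and \<open>Q\<close>-triples over the
  rearrangements of \<open>b\<close>.  Reading the columns in another order does not change the distribution for
  quinv: exchanging two neighbouring columns is compensated by exchanging, if necessary, the two
  entries of \<open>b\<close>.  In particular one may sort the columns by their upper entry, increasingly or
  decreasingly.  Each of the eight pattern statistics is obtained by choosing one of these two orders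
  independently for the pairs of two descent columns, the pairs of two non-descent columns and the
  mixed pairs.  Given the order for mixed pairs, the other two choices do not matter, because
  rearranging \<open>b\<close> inside the set of descent columns, or inside its complement, preserves the
  contribution of the mixed pairs.\<close>

subsection \<open>Sums over pairs in a list\<close>

fun pairsum :: "('a \<Rightarrow> 'a \<Rightarrow> nat) \<Rightarrow> 'a list \<Rightarrow> nat" where
  "pairsum f [] = 0"
| "pairsum f (x # xs) = (\<Sum>y\<leftarrow>xs. f x y) + pairsum f xs"

lemma pairsum_append:
  "pairsum f (xs @ ys) = pairsum f xs + pairsum f ys + (\<Sum>x\<leftarrow>xs. \<Sum>y\<leftarrow>ys. f x y)"
  by (induction xs) auto

lemma pairsum_cong:
  "(\<And>x y. x \<in> set xs \<Longrightarrow> y \<in> set xs \<Longrightarrow> f x y = g x y) \<Longrightarrow> pairsum f xs = pairsum g xs"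
  by (induction xs) (auto intro!: arg_cong[where f = sum_list])

lemma pairsum_map: "pairsum f (map h xs) = pairsum (\<lambda>x y. f (h x) (h y)) xs"
  by (induction xs) (auto simp: o_def)

lemma pairsum_perm:
  assumes "mset xs = mset ys" "distinct xs"
    and sym: "\<And>x y. x \<in> set xs \<Longrightarrow> y \<in> set xs \<Longrightarrow> x \<noteq> y \<Longrightarrow> f x y = f y x"
  shows "pairsum f xs = pairsum f ys"
  using assms
proof (induction xs arbitrary: ys)
  case (Cons a xs)
  have "a \<in> set ys"
    using Cons.prems(1) by (metis list.set_intros(1) mset_eq_setD)
  then obtain p s where ys: "ys = p @ a # s"
    by (meson split_list)
  have m: "mset xs = mset (p @ s)"
    using Cons.prems(1) ys by simp
  have "set xs = set (p @ s)"
    using m mset_eq_setD by blast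
  with Cons.prems have "(\<Sum>x\<leftarrow>p. f x a) = (\<Sum>x\<leftarrow>p. f a x)"
    by (intro arg_cong[where f = sum_list] map_cong) auto
  moreover have "(\<Sum>x\<leftarrow>xs. f a x) = (\<Sum>x\<leftarrow>p @ s. f a x)"
    using m by (metis mset_map sum_mset_sum_list)
  moreover have "pairsum f xs = pairsum f (p @ s)"
    using Cons m by auto
  ultimately show ?case
    by (simp add: ys pairsum_append sum_list_addf)
qed simp

text \<open>With \<open>P\<close> the set of descent columns this separates the three kinds of
  pairs; the last summand keeps only the mixed ones.\<close>

lemma pairsum_split:
  "pairsum f xs = pairsum f (filter P xs) + pairsum f (filter (\<lambda>x. \<not> P x) xs)
     + pairsum (\<lambda>x y. if P x = P y then 0 else f x y) xs"
proof (induction xs)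
  case (Cons a xs)
  have "(\<Sum>y\<leftarrow>xs. f a y) = (\<Sum>y\<leftarrow>filter (\<lambda>y. P a = P y) xs. f a y)
      + (\<Sum>y\<leftarrow>xs. if P a = P y then 0 else f a y)"
    by (induction xs) auto
  with Cons show ?case by (cases "P a") simp_all
qed simp

text \<open>Symmetry allows each mixed pair to be written with its \<open>P\<close>-element first.
  The result is a sum over a product set, whose two factors can be reindexed independently.\<close>

lemma pairsum_cross:
  assumes "distinct xs"
    and "\<And>x y. x \<in> set xs \<Longrightarrow> y \<in> set xs \<Longrightarrow> x \<noteq> y \<Longrightarrow> f x y = f y x"
  shows "pairsum (\<lambda>x y. if P x = P y then 0 else f x y) xs
    = (\<Sum>x | x \<in> set xs \<and> P x. \<Sum>y | y \<in> set xs \<and> \<not> P y. f x y)"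
  using assms
proof (induction xs)
  case (Cons a xs)
  let ?D = "{x \<in> set xs. P x}" and ?N = "{x \<in> set xs. \<not> P x}"
  have fin: "finite ?D" "finite ?N" by auto
  have IH: "pairsum (\<lambda>x y. if P x = P y then 0 else f x y) xs = (\<Sum>x\<in>?D. \<Sum>y\<in>?N. f x y)"
    using Cons by auto
  have row: "(\<Sum>y\<leftarrow>xs. if P a = P y then 0 else f a y)
      = (\<Sum>y | y \<in> set xs \<and> P a \<noteq> P y. f a y)"
    using Cons.prems(1)
    by (simp add: sum.distinct_set_conv_list[symmetric])
       (rule sum.mono_neutral_cong_right, auto)
  show ?case
  proof (cases "P a")
    case True
    have "{x \<in> set (a # xs). P x} = insert a ?D" "{x \<in> set (a # xs). \<not> P x} = ?N" "a \<notin> ?D"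
      using True Cons.prems(1) by auto
    then show ?thesis using IH row True fin by simp
  next
    case False
    have s: "{x \<in> set (a # xs). P x} = ?D" "{x \<in> set (a # xs). \<not> P x} = insert a ?N" "a \<notin> ?N"
      using False Cons.prems(1) by auto
    have "(\<Sum>x\<in>?D. f x a) = (\<Sum>x\<in>?D. f a x)"
      using Cons.prems by (intro sum.cong) auto
    then show ?thesis using IH row False fin s by (simp add: sum.distrib)
  qed
qed simp

lemma pairsum_sorted:
  assumes "sorted_wrt (<) (xs :: nat list)"
  shows "pairsum f xs = (\<Sum>(x, y) | x \<in> set xs \<and> y \<in> set xs \<and> x < y. f x y)"
  using assms
proof (induction xs)
  case (Cons a xs)
  let ?A = "\<lambda>xs. {(x, y). x \<in> set xs \<and> y \<in> set xs \<and> x < y}"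
  have split: "?A (a # xs) = Pair a ` set xs \<union> ?A xs" "Pair a ` set xs \<inter> ?A xs = {}"
    using Cons.prems by auto
  have fin: "finite (?A xs)"
    by (rule finite_subset[of _ "set xs \<times> set xs"]) auto
  have "distinct xs"
    using Cons.prems strict_sorted_iff by auto
  then have "(\<Sum>p\<in>Pair a ` set xs. case p of (x, y) \<Rightarrow> f x y) = (\<Sum>y\<leftarrow>xs. f a y)"
    by (simp add: sum.reindex inj_on_def sum.distinct_set_conv_list)
  then show ?case
    unfolding split(1) using Cons fin by (simp add: sum.union_disjoint[OF _ _ split(2)])
qed simp

lemma ex_sorted_wrt:
  assumes "finite I" "transp R" "totalp_on I R"
  shows "\<exists>L. distinct L \<and> set L = I \<and> sorted_wrt R L"
  using assms(1,3)
proof (induction I rule: finite_induct)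
  case (insert x I)
  then obtain L where L: "distinct L" "set L = I" "sorted_wrt R L"
    by (metis insert_iff totalp_on_def)
  let ?L = "filter (\<lambda>y. R y x) L @ x # filter (\<lambda>y. \<not> R y x) L"
  have "sorted_wrt R ?L"
    using L insert assms(2)
    by (simp add: sorted_wrt_append sorted_wrt_filter totalp_on_def)
       (metis transpD)
  moreover have "distinct ?L" "set ?L = insert x I"
    using L insert by auto
  ultimately show ?case by blast
qed simp

subsection \<open>Reordering columns\<close>

text \<open>Reading the values cyclically upwards from \<open>a\<close>, with \<open>a\<close>
  itself first, \<open>Q a u v\<close> says for \<open>u \<noteq> v\<close> that \<open>u\<close> is
  met before \<open>v\<close>.\<close>

lemma Q_antisym: "u \<noteq> v \<Longrightarrow> Q a v u \<longleftrightarrow> \<not> Q a u v"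
  unfolding Q_def by linarith

text \<open>\<open>Q a b c\<close> says that \<open>c\<close> lies in the open cyclic interval from \<open>b\<close> to \<open>a\<close>; the term
  \<open>b < a\<close> corrects for the wrap-around.\<close>

lemma Q_eq: "of_bool (Q a b c) + of_bool (b < a) = (of_bool (b < c) + of_bool (c < a) :: nat)"
  unfolding Q_def by (cases "a < b"; cases "b < a") auto

text \<open>The hypothesis forces \<open>u \<noteq> v\<close> and then, by \<open>Q_antisym\<close>,
  means \<open>Q z u v = Q y u v\<close>: \<open>z\<close> and \<open>y\<close> lie on the same
  half-open cyclic arc between \<open>u\<close> and \<open>v\<close>. The difference of the
  indicators of \<open>u < z\<close> and \<open>v < z\<close> depends only on that arc.\<close>

lemma flip_des: "Q z u v \<noteq> Q y v u \<Longrightarrow>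
   of_bool (u < z) + of_bool (v < y) = (of_bool (v < z) + of_bool (u < y) :: nat)"
  unfolding Q_def of_bool_def by (simp split: if_splits) linarith

text \<open>Expanding all four terms by \<open>Q_eq\<close>, the comparisons with \<open>t\<close>
  cancel, and the wrap-around corrections that remain balance by \<open>flip_des\<close>.\<close>

lemma flip_out: "Q z u v \<noteq> Q y v u \<Longrightarrow>
   of_bool (Q z u t) + of_bool (Q y v t) = (of_bool (Q z v t) + of_bool (Q y u t) :: nat)"
  using flip_des[of z u v y] Q_eq[of z u t] Q_eq[of y v t] Q_eq[of z v t] Q_eq[of y u t]
  by linarith

section \<open>Row statistics and their equidistribution\<close>

definition row_des :: "nat set \<Rightarrow> (nat \<Rightarrow> nat) \<Rightarrow> (nat \<Rightarrow> nat) \<Rightarrow> nat" where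
  "row_des I w b = (\<Sum>i\<in>I. of_bool (b i < w i))"

text \<open>The list \<open>L\<close> is the order in which the columns are read.\<close>

definition row_quinv :: "(nat \<Rightarrow> nat) \<Rightarrow> (nat \<Rightarrow> nat) \<Rightarrow> nat list \<Rightarrow> nat" where
  "row_quinv w b L = pairsum (\<lambda>i j. of_bool (Q (w i) (b i) (b j))) L"

text \<open>The permutation may depend on \<open>b\<close>. Two upper rows occur because the row
  above has already been rearranged when \<open>b\<close> is treated. Injectivity suffices here:
  bijectivity follows later by finiteness.\<close>

definition equidist ::
  "nat set \<Rightarrow> (nat \<Rightarrow> nat) \<Rightarrow> ((nat \<Rightarrow> nat) \<Rightarrow> nat) \<Rightarrow> (nat \<Rightarrow> nat) \<Rightarrow> ((nat \<Rightarrow> nat) \<Rightarrow> nat) \<Rightarrow> bool"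
where
  "equidist I w f w' g \<longleftrightarrow> (\<exists>\<phi>. inj \<phi> \<and>
     (\<forall>b. (\<exists>p. p permutes I \<and> \<phi> b = b \<circ> p) \<and> row_des I w' (\<phi> b) = row_des I w b \<and> g (\<phi> b) = f b))"

lemma equidistI:
  assumes "inj \<phi>" "\<And>b. \<exists>p. p permutes I \<and> \<phi> b = b \<circ> p"
    "\<And>b. row_des I w' (\<phi> b) = row_des I w b" "\<And>b. g (\<phi> b) = f b"
  shows "equidist I w f w' g"
  using assms unfolding equidist_def by blast

lemma equidist_refl: "(\<And>b. f b = g b) \<Longrightarrow> equidist I w f w g"
  by (rule equidistI[where \<phi> = id]) (auto intro: permutes_id)

lemma equidist_trans:
  assumes "equidist I w f w' g" "equidist I w' g w'' h"
  shows "equidist I w f w'' h"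
proof -
  obtain \<phi> where \<phi>: "inj \<phi>" "\<And>b. \<exists>p. p permutes I \<and> \<phi> b = b \<circ> p"
    "\<And>b. row_des I w' (\<phi> b) = row_des I w b" "\<And>b. g (\<phi> b) = f b"
    using assms(1) unfolding equidist_def by metis
  obtain \<psi> where \<psi>: "inj \<psi>" "\<And>b. \<exists>p. p permutes I \<and> \<psi> b = b \<circ> p"
    "\<And>b. row_des I w'' (\<psi> b) = row_des I w' b" "\<And>b. h (\<psi> b) = g b"
    using assms(2) unfolding equidist_def by metis
  show ?thesis
  proof (rule equidistI[where \<phi> = "\<psi> \<circ> \<phi>"])
    fix b
    show "\<exists>p. p permutes I \<and> (\<psi> \<circ> \<phi>) b = b \<circ> p"
    proof -
      obtain p where p: "p permutes I" "\<phi> b = b \<circ> p" using \<phi>(2) by blast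
      obtain q where q: "q permutes I" "\<psi> (\<phi> b) = \<phi> b \<circ> q" using \<psi>(2) by blast
      show ?thesis
        using permutes_compose[OF q(1) p(1)] p(2) q(2) by (auto simp: comp_assoc)
    qed
  qed (use \<phi> \<psi> in \<open>auto intro: inj_compose\<close>)
qed

text \<open>The two lower entries are exchanged exactly when the value of \<open>Q\<close> on the two columns would
  otherwise change.  In that case none or both of them lie between the two upper entries, so the
  exchange keeps the number of descents.\<close>

lemma equidist_flip:
  assumes "distinct (xs @ i # j # ys)"
  shows "equidist (set (xs @ i # j # ys)) w (\<lambda>b. row_quinv w b (xs @ i # j # ys))
    w (\<lambda>b. row_quinv w b (xs @ j # i # ys))"
proof -
  let ?L = "xs @ i # j # ys"
  let ?keep = "\<lambda>b. Q (w i) (b i) (b j) = Q (w j) (b j) (b i)"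
  let ?\<phi> = "\<lambda>b. if ?keep b then b else b \<circ> transpose i j"
  have ij: "i \<noteq> j" "\<And>k. k \<in> set (xs @ ys) \<Longrightarrow> k \<noteq> i \<and> k \<noteq> j"
    using assms by auto
  have other: "transpose i j k = k" if "k \<in> set (xs @ ys)" for k
    using ij(2)[OF that] by simp
  \<comment> \<open>By \<open>Q_antisym\<close> the exchange negates both sides of
    \<open>?keep\<close>, so the same case applies again and the map is an involution.\<close>
  have "?\<phi> (?\<phi> b) = b" for b
  proof (cases "?keep b")
    case False
    then have "b i \<noteq> b j" by (auto simp: Q_def)
    with False have *: "\<not> ?keep (b \<circ> transpose i j)"
      using Q_antisym[of "b i" "b j" "w i"] Q_antisym[of "b i" "b j" "w j"] by simp
    show ?thesis
      unfolding if_not_P[OF False] if_not_P[OF *] by (simp add: comp_assoc)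
  qed simp
  then have inj: "inj ?\<phi>" by (intro inj_on_inverseI[where g = ?\<phi>])
  have row_des: "row_des (set ?L) w (?\<phi> b) = row_des (set ?L) w b" for b
  proof (cases "?keep b")
    case False
    let ?R = "set xs \<union> set ys"
    have L: "set ?L = insert i (insert j ?R)" "i \<notin> insert j ?R" "j \<notin> ?R" "finite ?R"
      using assms by auto
    have R: "(\<Sum>k\<in>?R. of_bool ((b \<circ> transpose i j) k < w k)) = (\<Sum>k\<in>?R. of_bool (b k < w k) :: nat)"
      using other by (intro sum.cong) auto
    have e: "(\<Sum>k\<in>set ?L. of_bool (c k < w k)) = of_bool (c i < w i) + (of_bool (c j < w j)
        + (\<Sum>k\<in>?R. of_bool (c k < w k) :: nat))" for c
      unfolding L(1) using L by (simp del: sum_of_bool_eq)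
    show ?thesis
      unfolding if_not_P[OF False] row_des_def e R
      unfolding o_apply transpose_apply_first transpose_apply_second
      using flip_des[OF False] by linarith
  qed simp
  have stat: "row_quinv w (?\<phi> b) (xs @ j # i # ys) = row_quinv w b ?L" for b
  proof (cases "?keep b")
    case True
    then show ?thesis
      by (simp add: row_quinv_def pairsum_append sum_list_addf)
  next
    case False
    let ?b = "b \<circ> transpose i j"
    have bij: "?b i = b j" "?b j = b i" by auto
    have "b i \<noteq> b j" using False by (auto simp: Q_def)
    \<comment> \<open>The left side is what the pair contributes after the exchange, when column
      \<open>j\<close> is read first and carries the entry \<open>b i\<close>.\<close>
    then have pair: "Q (w j) (b i) (b j) = Q (w i) (b i) (b j)"
      using False Q_antisym by blast
    have p: "pairsum (\<lambda>k l. of_bool (Q (w k) (?b k) (?b l))) zs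
        = pairsum (\<lambda>k l. of_bool (Q (w k) (b k) (b l))) zs" if "set zs \<subseteq> set (xs @ ys)" for zs
      using that other by (intro pairsum_cong) (simp add: subset_eq)
    have xy: "(\<Sum>k\<leftarrow>xs. \<Sum>l\<leftarrow>ys. of_bool (Q (w k) (?b k) (?b l)))
        = (\<Sum>k\<leftarrow>xs. \<Sum>l\<leftarrow>ys. of_bool (Q (w k) (b k) (b l)) :: nat)"
      using other by (intro arg_cong[where f = sum_list] map_cong refl) auto
    \<comment> \<open>Earlier columns see the two exchanged entries only as third arguments of
      \<open>Q\<close>, so the sum over both entries is unchanged. For later columns the balance is
      \<open>flip_out\<close>, term by term.\<close>
    have x: "(\<Sum>k\<leftarrow>xs. of_bool (Q (w k) (?b k) c)) = (\<Sum>k\<leftarrow>xs. of_bool (Q (w k) (b k) c) :: nat)" for c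
      using other by (intro arg_cong[where f = sum_list] map_cong refl) auto
    have y: "(\<Sum>l\<leftarrow>ys. of_bool (Q (w i) (b j) (?b l))) + (\<Sum>l\<leftarrow>ys. of_bool (Q (w j) (b i) (?b l)))
        = (\<Sum>l\<leftarrow>ys. of_bool (Q (w i) (b i) (b l))) + (\<Sum>l\<leftarrow>ys. of_bool (Q (w j) (b j) (b l)) :: nat)"
      unfolding sum_list_addf[symmetric]
      using other flip_out[OF False] by (intro arg_cong[where f = sum_list] map_cong refl) auto
    show ?thesis
      unfolding if_not_P[OF False] row_quinv_def
      using p[of xs] p[of ys] xy x[of "b i"] x[of "b j"] y pair
      by (simp add: pairsum_append sum_list_addf bij del: o_apply)
  qed
  show ?thesis
  proof (rule equidistI[where \<phi> = ?\<phi>])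
    show "\<exists>p. p permutes set ?L \<and> ?\<phi> b = b \<circ> p" for b
    proof (cases "?keep b")
      case True
      have "id permutes set ?L" by (rule permutes_id)
      with True show ?thesis by (metis comp_id)
    next
      case False
      have "transpose i j permutes set ?L" by (rule permutes_swap_id) auto
      with False show ?thesis by metis
    qed
  qed (use inj row_des stat in auto)
qed

lemma equidist_move:
  assumes "distinct (q @ p @ a # s)"
  shows "equidist (set (q @ p @ a # s)) w (\<lambda>b. row_quinv w b (q @ p @ a # s)) w (\<lambda>b. row_quinv w b (q @ a # p @ s))"
  using assms
proof (induction p arbitrary: s rule: rev_induct)
  case Nil
  show ?case by (simp add: equidist_refl)
next
  case (snoc x p)
  have "equidist (set (q @ p @ x # a # s)) w (\<lambda>b. row_quinv w b ((q @ p) @ x # a # s))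
      w (\<lambda>b. row_quinv w b ((q @ p) @ a # x # s))"
    using equidist_flip[of "q @ p" x a s w] snoc.prems by simp
  moreover have "equidist (set (q @ p @ a # x # s)) w (\<lambda>b. row_quinv w b (q @ p @ a # x # s))
      w (\<lambda>b. row_quinv w b (q @ a # p @ x # s))"
    by (rule snoc.IH) (use snoc.prems in auto)
  moreover have "set (q @ p @ x # a # s) = set (q @ p @ a # x # s)"
    by auto
  ultimately show ?case
    using equidist_trans by simp
qed

text \<open>The prefix \<open>q\<close> holds the columns already in final position; each induction
  step moves the next column of \<open>L'\<close> directly behind it.\<close>

lemma equidist_reorder_prefix:
  assumes "mset L = mset L'" "distinct (q @ L)"
  shows "equidist (set (q @ L)) w (\<lambda>b. row_quinv w b (q @ L)) w (\<lambda>b. row_quinv w b (q @ L'))"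
  using assms
proof (induction L' arbitrary: q L)
  case Nil
  then show ?case by (simp add: equidist_refl)
next
  case (Cons a L')
  have "a \<in> set L"
    using mset_eq_setD[OF Cons.prems(1)] by simp
  then obtain p s where L: "L = p @ a # s"
    by (meson split_list)
  have "equidist (set (q @ L)) w (\<lambda>b. row_quinv w b (q @ L)) w (\<lambda>b. row_quinv w b (q @ a # p @ s))"
    using equidist_move[of q p a s] Cons.prems L by simp
  moreover have "equidist (set ((q @ [a]) @ p @ s)) w (\<lambda>b. row_quinv w b ((q @ [a]) @ p @ s))
      w (\<lambda>b. row_quinv w b ((q @ [a]) @ L'))"
    using Cons L by (intro Cons.IH) auto
  moreover have "set (q @ L) = set ((q @ [a]) @ p @ s)"
    using L by auto
  ultimately show ?case
    using equidist_trans by simp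
qed

lemma equidist_reorder:
  assumes "distinct L" "distinct L'" "set L = I" "set L' = I"
  shows "equidist I w (\<lambda>b. row_quinv w b L) w (\<lambda>b. row_quinv w b L')"
proof -
  have "mset L = mset L'"
    using assms set_eq_iff_mset_eq_distinct by blast
  then show ?thesis
    using equidist_reorder_prefix[of L L' "[]" w] assms by simp
qed

text \<open>Carrying whole columns along \<open>\<pi>\<close> changes nothing but their names. This
  is the step that replaces the upper row by a rearrangement of itself.\<close>

lemma equidist_relabel:
  assumes "\<pi> permutes I" "\<And>i. i \<in> I \<Longrightarrow> w' i = w (\<pi> i)" "set L \<subseteq> I"
  shows "equidist I w (\<lambda>b. row_quinv w b (map \<pi> L)) w' (\<lambda>b. row_quinv w' b L)"
proof (rule equidistI[where \<phi> = "\<lambda>b. b \<circ> \<pi>"])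
  show "inj (\<lambda>b :: nat \<Rightarrow> nat. b \<circ> \<pi>)"
    by (rule inj_on_inverseI[where g = "\<lambda>b. b \<circ> inv \<pi>"])
       (simp add: comp_assoc permutes_inv_o[OF assms(1)])
  show "\<exists>p. p permutes I \<and> b \<circ> \<pi> = b \<circ> p" for b :: "nat \<Rightarrow> nat"
    using assms(1) by blast
  show "row_des I w' (b \<circ> \<pi>) = row_des I w b" for b
    using assms(2) by (simp add: row_des_def sum.permute[OF assms(1), of "\<lambda>i. of_bool (b i < w i)"])
  show "row_quinv w' (b \<circ> \<pi>) L = row_quinv w b (map \<pi> L)" for b
    using assms by (auto simp: row_quinv_def pairsum_map intro!: pairsum_cong)
qed

subsection \<open>Column orders depending on the upper row\<close>

text \<open>With the flag \<open>True\<close> the column with the larger upper entry comes first, with \<open>False\<close> the one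
  with the smaller upper entry; ties keep the order of the columns.\<close>

definition before :: "bool \<Rightarrow> (nat \<Rightarrow> nat) \<Rightarrow> nat \<Rightarrow> nat \<Rightarrow> bool" where
  "before dir w i j \<longleftrightarrow> (if dir then w j < w i else w i < w j) \<or> (w i = w j \<and> i < j)"

definition Q_dir :: "bool \<Rightarrow> (nat \<Rightarrow> nat) \<Rightarrow> (nat \<Rightarrow> nat) \<Rightarrow> nat \<Rightarrow> nat \<Rightarrow> bool" where
  "Q_dir dir w b i j \<longleftrightarrow>
     (if before dir w i j then Q (w i) (b i) (b j) else Q (w j) (b j) (b i))"

text \<open>The three flags apply to pairs of descent columns, of non-descent columns, and to mixed pairs.\<close>

definition Q3 :: "bool \<Rightarrow> bool \<Rightarrow> bool \<Rightarrow> (nat \<Rightarrow> nat) \<Rightarrow> (nat \<Rightarrow> nat) \<Rightarrow> nat \<Rightarrow> nat \<Rightarrow> bool" where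
  "Q3 d1 d2 d3 w b i j \<longleftrightarrow>
     Q_dir (if b i < w i \<and> b j < w j then d1 else if w i \<le> b i \<and> w j \<le> b j then d2 else d3) w b i j"

lemma before_total: "i \<noteq> j \<Longrightarrow> before dir w j i \<longleftrightarrow> \<not> before dir w i j"
  unfolding before_def by auto

lemma Q_dir_commute: "i \<noteq> j \<Longrightarrow> Q_dir dir w b i j = Q_dir dir w b j i"
  unfolding Q_dir_def using before_total[of i j dir w] by simp

lemma Q3_commute: "i \<noteq> j \<Longrightarrow> Q3 d1 d2 d3 w b i j = Q3 d1 d2 d3 w b j i"
  unfolding Q3_def by (subst Q_dir_commute) (simp_all add: conj_commute)

lemma ex_before_list:
  assumes "finite I"
  shows "\<exists>L. distinct L \<and> set L = I \<and> sorted_wrt (before dir w) L"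
  using assms
proof (rule ex_sorted_wrt)
  show "transp (before dir w)"
    by (rule transpI) (auto simp: before_def split: if_splits)
  show "totalp_on I (before dir w)"
    by (rule totalp_onI) (use before_total in blast)
qed

lemma pairsum_cong_sorted:
  assumes "sorted_wrt R xs" "\<And>x y. x \<in> set xs \<Longrightarrow> y \<in> set xs \<Longrightarrow> R x y \<Longrightarrow> f x y = g x y"
  shows "pairsum f xs = pairsum g xs"
  using assms by (induction xs) (auto intro!: arg_cong[where f = sum_list])

text \<open>\<open>Q_dir\<close> is symmetric in the two columns, so the list may be sorted by
  \<open>before\<close>; then the first column of each pair is the one that \<open>Q_dir\<close>
  puts first.\<close>

lemma pairsum_Q_dir:
  assumes "sorted_wrt (before dir w) L" "distinct L" "distinct L'" "set L = set L'"
  shows "pairsum (\<lambda>i j. of_bool (Q_dir dir w b i j)) L' = row_quinv w b L"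
proof -
  have "pairsum (\<lambda>i j. of_bool (Q_dir dir w b i j)) L' = pairsum (\<lambda>i j. of_bool (Q_dir dir w b i j)) L"
  proof (rule pairsum_perm)
    show "mset L' = mset L" using assms set_eq_iff_mset_eq_distinct by blast
    show "of_bool (Q_dir dir w b i j) = (of_bool (Q_dir dir w b j i) :: nat)" if "i \<noteq> j" for i j
      using Q_dir_commute[OF that, of dir w b] by simp
  qed fact
  also have "\<dots> = row_quinv w b L"
    unfolding row_quinv_def using assms(1) by (rule pairsum_cong_sorted) (simp add: Q_dir_def)
  finally show ?thesis .
qed

lemma equidist_Q_dir:
  assumes "distinct L" "set L = I"
  shows "equidist I w (\<lambda>b. pairsum (\<lambda>i j. of_bool (Q_dir d w b i j)) L)
    w (\<lambda>b. pairsum (\<lambda>i j. of_bool (Q_dir d' w b i j)) L)"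
proof -
  have "finite I" using assms by auto
  obtain M where M: "distinct M" "set M = I" "sorted_wrt (before d w) M"
    using ex_before_list[OF \<open>finite I\<close>] by blast
  obtain M' where M': "distinct M'" "set M' = I" "sorted_wrt (before d' w) M'"
    using ex_before_list[OF \<open>finite I\<close>] by blast
  have *: "pairsum (\<lambda>i j. of_bool (Q_dir d w b i j)) L = row_quinv w b M"
    "pairsum (\<lambda>i j. of_bool (Q_dir d' w b i j)) L = row_quinv w b M'" for b
    using M M' assms by (auto intro: pairsum_Q_dir)
  show ?thesis
    unfolding * using M M' by (intro equidist_reorder) auto
qed

lemma equidist_qsum_Q_dir:
  assumes "image_mset w (mset_set I) = image_mset w' (mset_set I)"
    "distinct L" "set L = I"
  shows "equidist I w (\<lambda>b. row_quinv w b L) w' (\<lambda>b. pairsum (\<lambda>i j. of_bool (Q_dir d w' b i j)) L)"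
proof -
  have "finite I" using assms by auto
  obtain \<pi> where \<pi>: "\<pi> permutes I" "\<forall>i\<in>I. w' i = w (\<pi> i)"
    by (rule image_mset_eq_implies_permutes[OF \<open>finite I\<close> assms(1)[symmetric]])
  obtain M where M: "distinct M" "set M = I" "sorted_wrt (before d w') M"
    using ex_before_list[OF \<open>finite I\<close>] by blast
  have *: "pairsum (\<lambda>i j. of_bool (Q_dir d w' b i j)) L = row_quinv w' b M" for b
    using M assms by (intro pairsum_Q_dir) auto
  \<comment> \<open>\<open>map \<pi> M\<close> is the order in which the columns of \<open>w\<close>
    must be read so that relabelling by \<open>\<pi>\<close> yields the sorted order
    \<open>M\<close> for \<open>w'\<close>.\<close>
  have "distinct (map \<pi> M)"
    using M permutes_inj_on[OF \<pi>(1)] by (simp add: distinct_map)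
  moreover have "set (map \<pi> M) = I"
    using M permutes_image[OF \<pi>(1)] by simp
  ultimately have "equidist I w (\<lambda>b. row_quinv w b L) w (\<lambda>b. row_quinv w b (map \<pi> M))"
    using assms by (intro equidist_reorder) auto
  moreover have "equidist I w (\<lambda>b. row_quinv w b (map \<pi> M)) w' (\<lambda>b. row_quinv w' b M)"
    using \<pi> M by (intro equidist_relabel) auto
  ultimately show ?thesis
    unfolding * by (rule equidist_trans)
qed

section \<open>Invariance of the mixed pairs\<close>

lemma sum_reindex_invariant:
  assumes D: "bij_betw k D D" and N: "bij_betw k N N"
  shows "(\<Sum>i\<in>D. \<Sum>j\<in>N. f (b (k i)) (b (k j))) = (\<Sum>i\<in>D. \<Sum>j\<in>N. f (b i) (b j))"
    and "(\<Sum>i\<in>D. \<Sum>j\<in>N. g i (b (k j))) = (\<Sum>i\<in>D. \<Sum>j\<in>N. g i (b j))"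
    and "(\<Sum>i\<in>D. \<Sum>j\<in>N. h j (b (k i))) = (\<Sum>i\<in>D. \<Sum>j\<in>N. h j (b i))"
proof -
  have "(\<Sum>j\<in>N. f x (b (k j))) = (\<Sum>j\<in>N. f x (b j))" for x
    by (rule sum.reindex_bij_betw[OF N])
  then show "(\<Sum>i\<in>D. \<Sum>j\<in>N. f (b (k i)) (b (k j))) = (\<Sum>i\<in>D. \<Sum>j\<in>N. f (b i) (b j))"
    using sum.reindex_bij_betw[OF D, of "\<lambda>i. \<Sum>j\<in>N. f (b i) (b j)"] by simp
  show "(\<Sum>i\<in>D. \<Sum>j\<in>N. g i (b (k j))) = (\<Sum>i\<in>D. \<Sum>j\<in>N. g i (b j))"
    by (intro sum.cong refl sum.reindex_bij_betw[OF N])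
  show "(\<Sum>i\<in>D. \<Sum>j\<in>N. h j (b (k i))) = (\<Sum>i\<in>D. \<Sum>j\<in>N. h j (b i))"
    by (rule sum.reindex_bij_betw[OF D])
qed

text \<open>For a descent column \<open>i\<close> and a non-descent column \<open>j\<close> the value of \<open>Q_dir\<close> splits into terms
  whose sums over all such pairs see only the multisets of lower entries on the two sets of columns.\<close>

lemma Q_dir_mixed_True:
  assumes "b i < w i" "w j \<le> b j" "i \<noteq> j"
  shows "of_bool (Q_dir True w b i j) + of_bool (w i \<le> b j)
    = (of_bool (b i < b j) + of_bool (before True w j i) :: nat)"
proof (cases "before True w i j")
  case True
  then show ?thesis
    using assms Q_eq[of "w i" "b i" "b j"] before_total[OF assms(3)]
    by (cases "w i \<le> b j") (simp_all add: Q_dir_def)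
next
  case False
  \<comment> \<open>Now \<open>b i < w i \<le> w j \<le> b j\<close>, which forces \<open>Q\<close>
    to hold.\<close>
  then have "w i \<le> w j" by (auto simp: before_def)
  then have "Q (w j) (b j) (b i)" "w i \<le> b j" "b i < b j"
    using assms by (auto simp: Q_def)
  with False show ?thesis
    using before_total[OF assms(3)] by (simp add: Q_dir_def)
qed

lemma Q_dir_mixed_False:
  assumes "b i < w i" "w j \<le> b j" "i \<noteq> j"
  shows "of_bool (Q_dir False w b i j) + of_bool (before False w i j)
    = (of_bool (b j < b i) + of_bool (b i < w j) :: nat)"
proof (cases "before False w i j")
  case True
  \<comment> \<open>The same chain \<open>b i < w i \<le> w j \<le> b j\<close> here forces
    \<open>Q\<close> to fail.\<close>
  then have "w i \<le> w j" by (auto simp: before_def)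
  then have "\<not> Q (w i) (b i) (b j)" "b i < w j" "\<not> b j < b i"
    using assms by (auto simp: Q_def)
  with True show ?thesis by (simp add: Q_dir_def)
next
  case False
  then show ?thesis
    using assms Q_eq[of "w j" "b j" "b i"] by (simp add: Q_dir_def)
qed

text \<open>Summed over \<open>D\<close> and \<open>N\<close>, the identities for mixed pairs
  contain a term independent of the lower row and terms of the three shapes in
  \<open>sum_reindex_invariant\<close>. As \<open>k\<close> preserves \<open>D\<close> and
  \<open>N\<close> separately, none of these sums changes.\<close>

lemma sum_Q_dir_mixed_invariant:
  assumes "bij_betw k D D" "bij_betw k N N" "D \<inter> N = {}"
    and b: "\<And>i. i \<in> D \<Longrightarrow> b i < w i" "\<And>j. j \<in> N \<Longrightarrow> w j \<le> b j"
    and b': "\<And>i. i \<in> D \<Longrightarrow> b' i < w i" "\<And>j. j \<in> N \<Longrightarrow> w j \<le> b' j" "b' = b \<circ> k"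
  shows "(\<Sum>i\<in>D. \<Sum>j\<in>N. of_bool (Q_dir dir w b' i j)) = (\<Sum>i\<in>D. \<Sum>j\<in>N. of_bool (Q_dir dir w b i j) :: nat)"
proof -
  note inv = sum_reindex_invariant[OF assms(1,2)]
  have neq: "i \<noteq> j" if "i \<in> D" "j \<in> N" for i j
    using that assms(3) by auto
  show ?thesis
  proof (cases dir)
    case True
    have *: "(\<Sum>i\<in>D. \<Sum>j\<in>N. of_bool (Q_dir True w c i j)) + (\<Sum>i\<in>D. \<Sum>j\<in>N. of_bool (w i \<le> c j))
        = (\<Sum>i\<in>D. \<Sum>j\<in>N. of_bool (c i < c j)) + (\<Sum>i\<in>D. \<Sum>j\<in>N. of_bool (before True w j i) :: nat)"
      if "\<And>i. i \<in> D \<Longrightarrow> c i < w i" "\<And>j. j \<in> N \<Longrightarrow> w j \<le> c j" for c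
      unfolding sum.distrib[symmetric]
      by (intro sum.cong refl Q_dir_mixed_True that neq)
    have "(\<Sum>i\<in>D. \<Sum>j\<in>N. of_bool (b' i < b' j)) = (\<Sum>i\<in>D. \<Sum>j\<in>N. of_bool (b i < b j) :: nat)"
      "(\<Sum>i\<in>D. \<Sum>j\<in>N. of_bool (w i \<le> b' j)) = (\<Sum>i\<in>D. \<Sum>j\<in>N. of_bool (w i \<le> b j) :: nat)"
      unfolding b'(3) o_apply by (rule inv)+
    then show ?thesis
      using True *[OF b] *[OF b'(1,2)] by simp
  next
    case False
    have *: "(\<Sum>i\<in>D. \<Sum>j\<in>N. of_bool (Q_dir False w c i j)) + (\<Sum>i\<in>D. \<Sum>j\<in>N. of_bool (before False w i j))
        = (\<Sum>i\<in>D. \<Sum>j\<in>N. of_bool (c j < c i)) + (\<Sum>i\<in>D. \<Sum>j\<in>N. of_bool (c i < w j) :: nat)"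
      if "\<And>i. i \<in> D \<Longrightarrow> c i < w i" "\<And>j. j \<in> N \<Longrightarrow> w j \<le> c j" for c
      unfolding sum.distrib[symmetric]
      by (intro sum.cong refl Q_dir_mixed_False that neq)
    have "(\<Sum>i\<in>D. \<Sum>j\<in>N. of_bool (b' j < b' i)) = (\<Sum>i\<in>D. \<Sum>j\<in>N. of_bool (b j < b i) :: nat)"
      "(\<Sum>i\<in>D. \<Sum>j\<in>N. of_bool (b' i < w j)) = (\<Sum>i\<in>D. \<Sum>j\<in>N. of_bool (b i < w j) :: nat)"
      unfolding b'(3) o_apply by (rule inv)+
    then show ?thesis
      using False *[OF b] *[OF b'(1,2)] by simp
  qed
qed

section \<open>Changing the flags for unmixed pairs\<close>

lemma row_des_eq_card: "finite I \<Longrightarrow> row_des I w b = card {i \<in> I. b i < w i}"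
  unfolding row_des_def by (simp add: Int_def)

lemma pairsum_Q3:
  assumes "distinct L" "D = {i \<in> set L. b i < w i}"
  shows "pairsum (\<lambda>i j. of_bool (Q3 d1 d2 d3 w b i j)) L
    = pairsum (\<lambda>i j. of_bool (Q_dir d1 w b i j)) (filter (\<lambda>i. i \<in> D) L)
      + pairsum (\<lambda>i j. of_bool (Q_dir d2 w b i j)) (filter (\<lambda>i. i \<notin> D) L)
      + (\<Sum>i\<in>D. \<Sum>j\<in>set L - D. of_bool (Q_dir d3 w b i j))"
proof -
  have "pairsum (\<lambda>i j. of_bool (Q3 d1 d2 d3 w b i j)) (filter (\<lambda>i. i \<in> D) L)
      = pairsum (\<lambda>i j. of_bool (Q_dir d1 w b i j)) (filter (\<lambda>i. i \<in> D) L)"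
    by (intro pairsum_cong) (simp add: Q3_def assms(2))
  moreover have "pairsum (\<lambda>i j. of_bool (Q3 d1 d2 d3 w b i j)) (filter (\<lambda>i. i \<notin> D) L)
      = pairsum (\<lambda>i j. of_bool (Q_dir d2 w b i j)) (filter (\<lambda>i. i \<notin> D) L)"
    by (intro pairsum_cong) (auto simp: Q3_def assms(2) not_less)
  moreover have "pairsum (\<lambda>i j. if (i \<in> D) = (j \<in> D) then 0 else of_bool (Q3 d1 d2 d3 w b i j)) L
      = (\<Sum>i | i \<in> set L \<and> i \<in> D. \<Sum>j | j \<in> set L \<and> j \<notin> D. of_bool (Q3 d1 d2 d3 w b i j))"
    using assms(1) by (rule pairsum_cross) (rule arg_cong[where f = of_bool, OF Q3_commute])
  moreover have "\<dots> = (\<Sum>i\<in>D. \<Sum>j\<in>set L - D. of_bool (Q_dir d3 w b i j))"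
    using assms(2) by (intro sum.cong) (auto simp: Q3_def)
  ultimately show ?thesis
    by (subst pairsum_split[where P = "\<lambda>i. i \<in> D"]) simp
qed

text \<open>A change of direction is performed first inside the descent set of \<open>b\<close> and
  then inside its complement. Both steps preserve the descent set, so they affect neither each other
  nor the mixed pairs.\<close>

lemma equidist_Q3:
  assumes "distinct L" "set L = I"
  shows "equidist I w (\<lambda>b. pairsum (\<lambda>i j. of_bool (Q3 d1 d2 d3 w b i j)) L)
    w (\<lambda>b. pairsum (\<lambda>i j. of_bool (Q3 e1 e2 d3 w b i j)) L)"
proof -
  have fin: "finite I" using assms by auto
  let ?q = "\<lambda>d J b. pairsum (\<lambda>i j. of_bool (Q_dir d w b i j)) (filter (\<lambda>i. i \<in> J) L)"
  \<comment> \<open>The maps are chosen uniformly for all sets \<open>J\<close> of columns, since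
    the descent set to which they are applied varies with \<open>b\<close>.\<close>
  have ex: "\<exists>\<phi>. \<forall>J. J \<subseteq> I \<longrightarrow> inj (\<phi> J) \<and> (\<forall>b. (\<exists>p. p permutes J \<and> \<phi> J b = b \<circ> p)
      \<and> row_des J w (\<phi> J b) = row_des J w b \<and> ?q e J (\<phi> J b) = ?q d J b)" for d e
  proof (rule choice, intro allI)
    fix J
    show "\<exists>\<phi>. J \<subseteq> I \<longrightarrow> inj \<phi> \<and> (\<forall>b. (\<exists>p. p permutes J \<and> \<phi> b = b \<circ> p)
      \<and> row_des J w (\<phi> b) = row_des J w b \<and> ?q e J (\<phi> b) = ?q d J b)"
    proof (cases "J \<subseteq> I")
      case True
      then have "equidist J w (?q d J) w (?q e J)"
        using assms by (intro equidist_Q_dir) auto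
      then show ?thesis unfolding equidist_def by blast
    qed blast
  qed
  obtain \<phi> where \<phi>: "\<And>J. J \<subseteq> I \<Longrightarrow> inj (\<phi> J)"
    "\<And>J b. J \<subseteq> I \<Longrightarrow> \<exists>p. p permutes J \<and> \<phi> J b = b \<circ> p"
    "\<And>J b. J \<subseteq> I \<Longrightarrow> row_des J w (\<phi> J b) = row_des J w b"
    "\<And>J b. J \<subseteq> I \<Longrightarrow> ?q e1 J (\<phi> J b) = ?q d1 J b"
    using ex[of e1 d1] by blast
  obtain \<psi> where \<psi>: "\<And>J. J \<subseteq> I \<Longrightarrow> inj (\<psi> J)"
    "\<And>J b. J \<subseteq> I \<Longrightarrow> \<exists>p. p permutes J \<and> \<psi> J b = b \<circ> p"
    "\<And>J b. J \<subseteq> I \<Longrightarrow> row_des J w (\<psi> J b) = row_des J w b"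
    "\<And>J b. J \<subseteq> I \<Longrightarrow> ?q e2 J (\<psi> J b) = ?q d2 J b"
    using ex[of e2 d2] by blast
  let ?D = "\<lambda>b. {i \<in> I. b i < w i}"
  let ?\<Phi> = "\<lambda>b. \<psi> (I - ?D b) (\<phi> (?D b) b)"
  have main: "(\<exists>p. p permutes I \<and> ?\<Phi> b = b \<circ> p) \<and> ?D (?\<Phi> b) = ?D b
    \<and> pairsum (\<lambda>i j. of_bool (Q3 e1 e2 d3 w (?\<Phi> b) i j)) L
      = pairsum (\<lambda>i j. of_bool (Q3 d1 d2 d3 w b i j)) L" for b
  proof -
    define D where "D = ?D b"
    define N where "N = I - D"
    define b1 where "b1 = \<phi> D b"
    define b2 where "b2 = \<psi> N b1"
    have sub: "D \<subseteq> I" "N \<subseteq> I" "D \<inter> N = {}" "finite D" "finite N"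
      using fin by (auto simp: D_def N_def)
    obtain p where p: "p permutes D" "b1 = b \<circ> p"
      using \<phi>(2)[OF sub(1)] b1_def by blast
    obtain p' where p': "p' permutes N" "b2 = b1 \<circ> p'"
      using \<psi>(2)[OF sub(2)] b2_def by blast
    have pN: "p j = j" if "j \<in> N" for j
      using permutes_not_in[OF p(1)] that sub(3) by auto
    have p'D: "p' i = i" if "i \<in> D" for i
      using permutes_not_in[OF p'(1)] that sub(3) by auto
    have bN: "b1 j = b j" if "j \<in> N" for j
      using p(2) pN[OF that] by simp
    have bD: "b2 i = b1 i" if "i \<in> D" for i
      using p'(2) p'D[OF that] by simp
    \<comment> \<open>All columns of \<open>D\<close> are descents of \<open>b\<close>, so
      preserving their number on \<open>D\<close> preserves each of them. On \<open>N\<close> the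
      number is 0, with the same effect.\<close>
    have "card {i \<in> D. b1 i < w i} = card D"
      using \<phi>(3)[OF sub(1), of b] sub(4) by (simp add: row_des_eq_card b1_def) (simp add: D_def)
    then have "{i \<in> D. b1 i < w i} = D"
      using sub(4) by (intro card_subset_eq) auto
    then have D1: "b1 i < w i" if "i \<in> D" for i
      using that by blast
    have "{j \<in> N. b j < w j} = {}"
      by (auto simp: N_def D_def)
    then have "{j \<in> N. b1 j < w j} = {}"
      using bN by auto
    then have "card {j \<in> N. b2 j < w j} = 0"
      using \<psi>(3)[OF sub(2), of b1] sub(5) by (simp add: row_des_eq_card b2_def)
    then have N2: "w j \<le> b2 j" if "j \<in> N" for j
      using that sub(5) by (auto simp: not_less[symmetric])
    have D2: "b2 i < w i" if "i \<in> D" for i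
      using D1 bD that by simp
    have D: "?D b2 = D"
    proof -
      have "I = D \<union> N" using sub by (auto simp: N_def)
      then show ?thesis using D2 N2 by fastforce
    qed
    have k: "b2 = b \<circ> (p \<circ> p')"
      using p p' by (simp add: comp_assoc)
    have kD: "bij_betw (p \<circ> p') D D"
      using permutes_imp_bij[OF p(1)] p'D bij_betw_cong[of D "p \<circ> p'" p D] by simp
    have kN: "bij_betw (p \<circ> p') N N"
      using permutes_imp_bij[OF p'(1)] pN permutes_in_image[OF p'(1)] bij_betw_cong[of N "p \<circ> p'" p' N] by simp
    have "p \<circ> p' permutes I"
      using permutes_compose[OF permutes_subset[OF p'(1) sub(2)] permutes_subset[OF p(1) sub(1)]] .
    moreover have "pairsum (\<lambda>i j. of_bool (Q3 e1 e2 d3 w b2 i j)) L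
      = pairsum (\<lambda>i j. of_bool (Q3 d1 d2 d3 w b i j)) L"
    proof -
      have f: "filter (\<lambda>i. i \<notin> D) L = filter (\<lambda>i. i \<in> N) L"
        using assms(2) by (intro filter_cong) (auto simp: N_def)
      have "?q e1 D b2 = ?q e1 D b1"
        using bD by (intro pairsum_cong) (simp add: Q_dir_def)
      also have "\<dots> = ?q d1 D b"
        using \<phi>(4)[OF sub(1)] b1_def by simp
      finally have 1: "?q e1 D b2 = ?q d1 D b" .
      have "?q e2 N b2 = ?q d2 N b1"
        using \<psi>(4)[OF sub(2)] b2_def by simp
      also have "\<dots> = ?q d2 N b"
        using bN by (intro pairsum_cong) (simp add: Q_dir_def)
      finally have 2: "?q e2 N b2 = ?q d2 N b" .
      have 3: "(\<Sum>i\<in>D. \<Sum>j\<in>N. of_bool (Q_dir d3 w b2 i j)) = (\<Sum>i\<in>D. \<Sum>j\<in>N. of_bool (Q_dir d3 w b i j) :: nat)"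
        by (rule sum_Q_dir_mixed_invariant[OF kD kN sub(3) _ _ D2 N2 k]) (auto simp: D_def N_def)
      have "D = {i \<in> set L. b2 i < w i}" "D = {i \<in> set L. b i < w i}"
        using D D_def assms(2) by auto
      note e = this[THEN pairsum_Q3[OF assms(1)]]
      show ?thesis
        unfolding e f assms(2) N_def[symmetric] 1 2 3 by simp
    qed
    ultimately have "(\<exists>p. p permutes I \<and> b2 = b \<circ> p) \<and> ?D b2 = D
      \<and> pairsum (\<lambda>i j. of_bool (Q3 e1 e2 d3 w b2 i j)) L
        = pairsum (\<lambda>i j. of_bool (Q3 d1 d2 d3 w b i j)) L"
      using k D by blast
    then show ?thesis
      unfolding b2_def b1_def N_def D_def .
  qed
  define \<Phi> where "\<Phi> = ?\<Phi>"
  have \<Phi>: "\<exists>p. p permutes I \<and> \<Phi> b = b \<circ> p" "?D (\<Phi> b) = ?D b"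
    "pairsum (\<lambda>i j. of_bool (Q3 e1 e2 d3 w (\<Phi> b) i j)) L
      = pairsum (\<lambda>i j. of_bool (Q3 d1 d2 d3 w b i j)) L" for b
    unfolding \<Phi>_def
    by (rule main[THEN conjunct1], rule main[THEN conjunct2, THEN conjunct1],
        rule main[THEN conjunct2, THEN conjunct2])
  show ?thesis
  proof (rule equidistI[where \<phi> = \<Phi>])
    show "inj \<Phi>"
    proof (rule injI)
      fix b c assume eq: "\<Phi> b = \<Phi> c"
      \<comment> \<open>The image determines the descent set of its source, so both sources were
        treated by the same pair of injective maps.\<close>
      have D: "?D b = ?D c"
        using \<Phi>(2)[of b] \<Phi>(2)[of c] unfolding eq by (rule trans[OF sym])
      have "\<psi> (I - ?D c) (\<phi> (?D c) b) = \<psi> (I - ?D c) (\<phi> (?D c) c)"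
        using eq unfolding \<Phi>_def D .
      moreover have "inj (\<psi> (I - ?D c))" "inj (\<phi> (?D c))"
        by (rule \<psi>(1), blast) (rule \<phi>(1), blast)
      ultimately show "b = c"
        by (blast dest: injD)
    qed
    show "row_des I w (\<Phi> b) = row_des I w b" for b
      unfolding row_des_eq_card[OF fin] \<Phi>(2) ..
  qed (fact \<Phi>)+
qed

text \<open>With all flags equal to \<open>d3\<close>, \<open>Q3\<close> is \<open>Q_dir d3\<close>,
  which is reached from quinv; the first two flags are adjusted afterwards.\<close>

lemma equidist_qsum_Q3:
  assumes "image_mset w (mset_set I) = image_mset w' (mset_set I)"
    "distinct L" "set L = I"
  shows "equidist I w (\<lambda>b. row_quinv w b L) w' (\<lambda>b. pairsum (\<lambda>i j. of_bool (Q3 d1 d2 d3 w' b i j)) L)"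
proof -
  have "Q3 d3 d3 d3 = Q_dir d3"
    by (intro ext) (simp add: Q3_def)
  then have "equidist I w' (\<lambda>b. pairsum (\<lambda>i j. of_bool (Q_dir d3 w' b i j)) L)
      w' (\<lambda>b. pairsum (\<lambda>i j. of_bool (Q3 d1 d2 d3 w' b i j)) L)"
    using equidist_Q3[OF assms(2,3), of w' d3 d3 d3 d1 d2] by simp
  with equidist_qsum_Q_dir[OF assms] show ?thesis
    by (rule equidist_trans)
qed

subsection \<open>The eight pattern sets\<close>

text \<open>The eight pattern sets arise from three binary choices: \<open>d1\<close> for two
  descents, \<open>d2\<close> for two non-descents, \<open>d3\<close> for mixed pairs.\<close>

definition chains :: "bool \<Rightarrow> bool \<Rightarrow> bool \<Rightarrow> pattern" where
  "chains d1 d2 d3 z w u v \<longleftrightarrow>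
     z > v \<and> v \<ge> w \<and> w > u \<or> u \<ge> z \<and> z > v \<and> v \<ge> w \<or>
     (if d1 then z > w \<and> w > v \<and> v > u else z > w \<and> w > u \<and> u > v) \<or>
     (if d2 then v > u \<and> u \<ge> z \<and> z > w else u > v \<and> v \<ge> z \<and> z > w) \<or>
     (if d3 then z > v \<and> v > u \<and> u \<ge> w \<or> u \<ge> z \<and> z > w \<and> w > v
      else z > u \<and> u > v \<and> v \<ge> w \<or> v \<ge> z \<and> z > w \<and> w > u)"

lemma chains_less: "chains d1 d2 d3 z w u v \<Longrightarrow> w < z"
  unfolding chains_def by (auto split: if_splits)

text \<open>The two chains common to all sets are the configurations where both orders of the
  columns give \<open>Q\<close>. The chains governed by a flag are those where exactly one order
  does, the larger upper entry first for \<open>True\<close>.\<close>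

lemma chains_eq_Q:
  assumes "w < z"
  shows "chains d1 d2 d3 z w u v \<longleftrightarrow>
    (if (if u < z \<and> v < w then d1 else if z \<le> u \<and> w \<le> v then d2 else d3) then Q z u v else Q w v u)"
proof -
  have "u < w \<or> w \<le> u \<and> u < z \<or> z \<le> u" "v < w \<or> w \<le> v \<and> v < z \<or> z \<le> v"
    "u < v \<or> u = v \<or> v < u"
    by linarith+
  then show ?thesis
    using assms by (elim disjE) (auto simp: chains_def Q_def)
qed

lemma S_star_eq_Q: "(\<exists>p \<in> S_star. p z w u v) \<longleftrightarrow> z = w \<and> Q z u v"
  unfolding S_star_def Q_def by auto

lemma Q_S_chains:
  assumes "\<And>z w u v. (\<exists>p \<in> S. p z w u v) \<longleftrightarrow> chains d1 d2 d3 z w u v" "i < j"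
  shows "Q_S S (w i) (w j) (b i) (b j) \<longleftrightarrow> Q3 d1 d2 d3 w b i j"
proof -
  have *: "Q_S S (w i) (w j) (b i) (b j) \<longleftrightarrow> w i = w j \<and> Q (w i) (b i) (b j) \<or>
      chains d1 d2 d3 (w i) (w j) (b i) (b j) \<or> chains d1 d2 d3 (w j) (w i) (b j) (b i)"
    unfolding Q_S_def assms(1) S_star_eq_Q ..
  show ?thesis
  proof (cases "w i" "w j" rule: linorder_cases)
    case less
    \<comment> \<open>Every chain has the larger upper entry in its first argument, so only the
      swapped chains can match.\<close>
    then have "Q_S S (w i) (w j) (b i) (b j) \<longleftrightarrow> chains d1 d2 d3 (w j) (w i) (b j) (b i)"
      unfolding * using chains_less by (metis order_less_asym)
    then show ?thesis
      using less unfolding chains_eq_Q[OF less] Q3_def Q_dir_def before_def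
      by (simp add: conj_commute)
  next
    case equal
    then show ?thesis
      unfolding * using assms(2) by (auto simp: Q3_def Q_dir_def before_def dest: chains_less)
  next
    case greater
    then have "Q_S S (w i) (w j) (b i) (b j) \<longleftrightarrow> chains d1 d2 d3 (w i) (w j) (b i) (b j)"
      unfolding * using chains_less by (metis order_less_asym)
    then show ?thesis
      using greater unfolding chains_eq_Q[OF greater] Q3_def Q_dir_def before_def
      by simp
  qed
qed

lemma pattern_sets_chains:
  "(\<exists>p \<in> S1. p z w u v) \<longleftrightarrow> chains True False False z w u v"
  "(\<exists>p \<in> S2. p z w u v) \<longleftrightarrow> chains True True False z w u v"
  "(\<exists>p \<in> S3. p z w u v) \<longleftrightarrow> chains False False False z w u v"
  "(\<exists>p \<in> S4. p z w u v) \<longleftrightarrow> chains False True False z w u v"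
  "(\<exists>p \<in> S5. p z w u v) \<longleftrightarrow> chains True False True z w u v"
  "(\<exists>p \<in> S6. p z w u v) \<longleftrightarrow> chains False False True z w u v"
  "(\<exists>p \<in> S7. p z w u v) \<longleftrightarrow> chains True True True z w u v"
  "(\<exists>p \<in> S8. p z w u v) \<longleftrightarrow> chains False True True z w u v"
  unfolding S1_def S2_def S3_def S4_def S5_def S6_def S7_def S8_def S_common_def chains_def
  by (simp_all add: disj_ac)

lemma A_plus_Q3:
  assumes "\<eta> \<in> A_plus"
  shows "\<exists>S d1 d2 d3. \<eta> = eta S \<and>
    (\<forall>w b i j. i < j \<longrightarrow> Q_S S (w i) (w j) (b i) (b j) = Q3 d1 d2 d3 w b i j)"
proof -
  have *: ?thesis
    if "\<eta> = eta S" "\<And>z w u v. (\<exists>p \<in> S. p z w u v) \<longleftrightarrow> chains d1 d2 d3 z w u v" for S d1 d2 d3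
    using that(1) Q_S_chains[OF that(2)] by blast
  show ?thesis
    using assms unfolding A_plus_def insert_iff empty_iff
    by (elim disjE FalseE) (erule *, rule pattern_sets_chains)+
qed

subsection \<open>Assembling the rows\<close>

text \<open>The argument after \<open>\<sigma>\<close> counts the rows downwards from the top row \<open>m\<close>.\<close>

primrec build_row :: "((nat \<Rightarrow> nat) \<Rightarrow> (nat \<Rightarrow> nat) \<Rightarrow> (nat \<Rightarrow> nat) \<Rightarrow> nat \<Rightarrow> nat) \<Rightarrow> nat \<Rightarrow> filling
    \<Rightarrow> nat \<Rightarrow> nat \<Rightarrow> nat" where
  "build_row \<theta> m \<sigma> 0 = \<sigma> m"
| "build_row \<theta> m \<sigma> (Suc k) = \<theta> (\<sigma> (m - k)) (build_row \<theta> m \<sigma> k) (\<sigma> (m - Suc k))"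

lemma image_mset_permutes:
  assumes "p permutes I" "b' = b \<circ> p"
  shows "image_mset b' (mset_set I) = image_mset b (mset_set I)"
  using image_mset_mset_set[OF permutes_inj_on[OF assms(1)], of I] permutes_image[OF assms(1)]
  by (simp add: assms(2) flip: multiset.map_comp)

text \<open>Going down from row \<open>m\<close>, \<open>step\<close> is applied with
  \<open>w\<close> the old and \<open>w'\<close> the new row above; these are rearrangements of each
  other by the previous steps. \<open>X\<close> has the form of the fillings of a rectangle.\<close>

lemma ex_row_bijection:
  fixes I :: "nat set" and m :: nat
  defines "X \<equiv> {\<sigma> :: filling. \<forall>r c. if r \<in> {1..m} \<and> c \<in> I then 0 < \<sigma> r c else \<sigma> r c = 0}"
  assumes fin: "finite I"
    and step: "\<And>w w'. image_mset w (mset_set I) = image_mset w' (mset_set I) \<Longrightarrow> equidist I w (f w) w' (g w')"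
  shows "\<exists>\<gamma>. bij_betw \<gamma> X X \<and> (\<forall>\<sigma>\<in>X. (\<forall>r. \<exists>p. p permutes I \<and> \<gamma> \<sigma> r = \<sigma> r \<circ> p) \<and>
    (\<forall>r\<ge>m. \<gamma> \<sigma> r = \<sigma> r) \<and>
    (\<forall>r. 1 \<le> r \<and> r < m \<longrightarrow>
       row_des I (\<gamma> \<sigma> (r + 1)) (\<gamma> \<sigma> r) = row_des I (\<sigma> (r + 1)) (\<sigma> r) \<and>
       g (\<gamma> \<sigma> (r + 1)) (\<gamma> \<sigma> r) = f (\<sigma> (r + 1)) (\<sigma> r)))"
proof -
  have "\<forall>w w'. \<exists>\<phi>. image_mset w (mset_set I) = image_mset w' (mset_set I) \<longrightarrow> inj \<phi> \<and>
     (\<forall>b. (\<exists>p. p permutes I \<and> \<phi> b = b \<circ> p) \<and> row_des I w' (\<phi> b) = row_des I w b \<and> g w' (\<phi> b) = f w b)"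
    using step unfolding equidist_def by blast
  then obtain \<theta> where
    \<theta>: "\<And>w w'. image_mset w (mset_set I) = image_mset w' (mset_set I) \<Longrightarrow> inj (\<theta> w w') \<and>
     (\<forall>b. (\<exists>p. p permutes I \<and> \<theta> w w' b = b \<circ> p) \<and> row_des I w' (\<theta> w w' b) = row_des I w b
       \<and> g w' (\<theta> w w' b) = f w b)"
    by metis
  define \<gamma> where "\<gamma> = (\<lambda>\<sigma> r. if 1 \<le> r \<and> r \<le> m then build_row \<theta> m \<sigma> (m - r) else \<sigma> r)"
  have top: "\<gamma> \<sigma> r = \<sigma> r" if "m \<le> r" for \<sigma> r
    using that by (auto simp: \<gamma>_def)
  have rec: "\<gamma> \<sigma> r = \<theta> (\<sigma> (Suc r)) (\<gamma> \<sigma> (Suc r)) (\<sigma> r)" if "1 \<le> r" "r < m" for \<sigma> r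
  proof -
    have "m - r = Suc (m - Suc r)" "m - (m - Suc r) = Suc r" "m - Suc (m - Suc r) = r"
      using that by auto
    then show ?thesis
      using that by (simp add: \<gamma>_def)
  qed
  have perm: "\<exists>p. p permutes I \<and> \<gamma> \<sigma> r = \<sigma> r \<circ> p" for \<sigma> r
  proof (cases "1 \<le> r \<and> r < m")
    case False
    then have "\<gamma> \<sigma> r = \<sigma> r" using top[of r \<sigma>] by (cases "r < m") (auto simp: \<gamma>_def)
    then show ?thesis using permutes_id[of I] by (intro exI[of _ id]) simp
  next
    case True
    from True have "r \<le> m" by simp
    then show ?thesis using True
    proof (induction r rule: inc_induct)
      case base then show ?case by simp
    next
      case (step r)
      have "image_mset (\<sigma> (Suc r)) (mset_set I) = image_mset (\<gamma> \<sigma> (Suc r)) (mset_set I)"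
      proof (cases "Suc r < m")
        case True
        then have "1 \<le> Suc r \<and> Suc r < m" by simp
        then obtain p where "p permutes I" "\<gamma> \<sigma> (Suc r) = \<sigma> (Suc r) \<circ> p"
          using step.IH by blast
        then show ?thesis using image_mset_permutes by metis
      qed (simp add: top)
      moreover have "\<gamma> \<sigma> r = \<theta> (\<sigma> (Suc r)) (\<gamma> \<sigma> (Suc r)) (\<sigma> r)"
        using rec step.prems by blast
      ultimately show ?case
        using \<theta> by metis
    qed
  qed
  have mset: "image_mset (\<sigma> r) (mset_set I) = image_mset (\<gamma> \<sigma> r) (mset_set I)" for \<sigma> r
    using perm[of \<sigma> r] image_mset_permutes by metis
  have inj: "inj_on \<gamma> X"
  proof (rule inj_onI)
    fix \<sigma> \<tau> assume X: "\<sigma> \<in> X" "\<tau> \<in> X" and eq: "\<gamma> \<sigma> = \<gamma> \<tau>"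
    have low: "\<rho> 0 = (\<lambda>_. 0)" if "\<rho> \<in> X" for \<rho>
      using that by (auto simp: X_def)
    \<comment> \<open>Once the rows \<open>Suc r\<close> of \<open>\<sigma>\<close> and
      \<open>\<tau>\<close> agree, their rows \<open>r\<close> pass through the same injective
      map.\<close>
    have row: "\<sigma> r = \<tau> r" if "r \<le> m" "1 \<le> r" for r
      using that
    proof (induction r rule: inc_induct)
      case base
      show ?case using top[of m \<sigma>] top[of m \<tau>] eq by simp
    next
      case (step r)
      then have "\<theta> (\<sigma> (Suc r)) (\<gamma> \<sigma> (Suc r)) (\<sigma> r) = \<theta> (\<sigma> (Suc r)) (\<gamma> \<sigma> (Suc r)) (\<tau> r)"
        using rec[of r \<sigma>] rec[of r \<tau>] eq by simp
      then show ?case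
        using \<theta>[OF mset[of \<sigma> "Suc r"]] by (blast dest: injD)
    qed
    show "\<sigma> = \<tau>"
    proof
      fix r
      show "\<sigma> r = \<tau> r"
      proof (cases "1 \<le> r \<and> r \<le> m")
        case False
        then show ?thesis
          using top[of r \<sigma>] top[of r \<tau>] eq low[OF X(1)] low[OF X(2)] by (cases r) auto
      qed (use row in blast)
    qed
  qed
  \<comment> \<open>\<open>X\<close> may be infinite, but \<open>\<gamma>\<close> maps each of these
    finite classes of rowwise rearrangements into itself, so there injectivity gives
    surjectivity.\<close>
  define K where "K \<sigma> = {\<tau> \<in> X. \<forall>r. \<exists>p. p permutes I \<and> \<tau> r = \<sigma> r \<circ> p}" for \<sigma>
  have \<gamma>X: "\<gamma> \<sigma> \<in> X" if "\<sigma> \<in> X" for \<sigma>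
  proof -
    have "if r \<in> {1..m} \<and> c \<in> I then 0 < \<gamma> \<sigma> r c else \<gamma> \<sigma> r c = 0" for r c
    proof -
      obtain p where p: "p permutes I" "\<gamma> \<sigma> r = \<sigma> r \<circ> p" using perm by blast
      have "p c \<in> I \<longleftrightarrow> c \<in> I" using permutes_in_image[OF p(1)] .
      then show ?thesis using that p(2) by (auto simp: X_def)
    qed
    then show ?thesis by (simp add: X_def)
  qed
  have finK: "finite (K \<sigma>)" for \<sigma>
  proof -
    let ?B = "\<Union>r\<in>{1..m}. (\<lambda>p. \<sigma> r \<circ> p) ` {p. p permutes I}"
    have "finite ?B" using finite_permutations[OF fin] by simp
    then have "finite {\<tau>. \<forall>r. (r \<in> {1..m} \<longrightarrow> \<tau> r \<in> ?B) \<and> (r \<notin> {1..m} \<longrightarrow> \<tau> r = (\<lambda>_. 0))}"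
      by (intro finite_set_of_finite_funs) auto
    moreover have "K \<sigma> \<subseteq> {\<tau>. \<forall>r. (r \<in> {1..m} \<longrightarrow> \<tau> r \<in> ?B) \<and> (r \<notin> {1..m} \<longrightarrow> \<tau> r = (\<lambda>_. 0))}"
    proof
      fix \<tau> assume \<tau>: "\<tau> \<in> K \<sigma>"
      have "\<tau> r \<in> ?B" if "r \<in> {1..m}" for r
        using \<tau> that unfolding K_def by blast
      moreover have "\<tau> r = (\<lambda>_. 0)" if "r \<notin> {1..m}" for r
        using \<tau> that by (auto simp: K_def X_def)
      ultimately show "\<tau> \<in> {\<tau>. \<forall>r. (r \<in> {1..m} \<longrightarrow> \<tau> r \<in> ?B) \<and> (r \<notin> {1..m} \<longrightarrow> \<tau> r = (\<lambda>_. 0))}"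
        by blast
    qed
    ultimately show ?thesis by (rule rev_finite_subset)
  qed
  have surj: "\<sigma> \<in> \<gamma> ` X" if "\<sigma> \<in> X" for \<sigma>
  proof -
    have "\<gamma> \<tau> \<in> K \<sigma>" if \<tau>: "\<tau> \<in> K \<sigma>" for \<tau>
    proof -
      have "\<exists>p. p permutes I \<and> \<gamma> \<tau> r = \<sigma> r \<circ> p" for r
      proof -
        obtain p where p: "p permutes I" "\<tau> r = \<sigma> r \<circ> p" using \<tau> K_def by blast
        obtain q where q: "q permutes I" "\<gamma> \<tau> r = \<tau> r \<circ> q" using perm by blast
        show ?thesis
          using permutes_compose[OF q(1) p(1)] p(2) q(2) by (auto simp: comp_assoc)
      qed
      then show ?thesis using \<gamma>X \<tau> by (simp add: K_def)
    qed
    moreover have "inj_on \<gamma> (K \<sigma>)"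
      using inj by (rule inj_on_subset) (auto simp: K_def)
    ultimately have "\<gamma> ` K \<sigma> = K \<sigma>"
      by (intro endo_inj_surj finK) auto
    moreover have "\<sigma> \<in> K \<sigma>"
      using that permutes_id[of I] unfolding K_def by (auto intro!: exI[of _ id])
    ultimately show ?thesis by (auto simp: K_def)
  qed
  have "bij_betw \<gamma> X X"
    using inj surj \<gamma>X by (auto simp: bij_betw_def)
  moreover have "row_des I (\<gamma> \<sigma> (r + 1)) (\<gamma> \<sigma> r) = row_des I (\<sigma> (r + 1)) (\<sigma> r) \<and>
       g (\<gamma> \<sigma> (r + 1)) (\<gamma> \<sigma> r) = f (\<sigma> (r + 1)) (\<sigma> r)" if "1 \<le> r" "r < m" for \<sigma> r
    using \<theta>[OF mset[of \<sigma> "Suc r"]] rec[OF that] by simp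
  ultimately show ?thesis
    using perm top by blast
qed

subsection \<open>Rectangular diagrams\<close>

text \<open>All parts are positive, so the first column meets every row and fixes the height; the
  empty diagram is treated apart because it does not determine its sides.\<close>

lemma rectangle_diagram:
  assumes "is_partition lam" "is_rectangle lam"
  obtains n where "diagram lam = {1..length lam} \<times> {1..n}"
proof -
  obtain m n where mn: "diagram lam = {1..m} \<times> {1..n}"
    using assms(2) unfolding is_rectangle_def by blast
  show thesis
  proof (cases "lam = []")
    case True
    then have "diagram lam = {1..length lam} \<times> {1..n}"
      by (auto simp: diagram_def)
    then show ?thesis by (rule that)
  next
    case False
    have first: "(r, 1) \<in> diagram lam \<longleftrightarrow> r \<in> {1..length lam}" for r
      using assms(1) nth_mem[of "r - 1" lam] by (auto simp: diagram_def is_partition_def Suc_le_eq)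
    have "(1, 1) \<in> diagram lam"
      unfolding first using False by (simp add: Suc_le_eq)
    then have "1 \<le> n" by (simp add: mn)
    then have "r \<in> {1..m} \<longleftrightarrow> r \<in> {1..length lam}" for r
      using first[of r] by (simp add: mn)
    then have "{1..m} = {1..length lam}" by blast
    show ?thesis
      using mn unfolding \<open>{1..m} = {1..length lam}\<close> by (rule that)
  qed
qed

lemma card_pairs:
  fixes m n :: nat
  shows "card {(r, c, d). r \<in> {1..m} \<and> 1 \<le> c \<and> c < d \<and> d \<le> n \<and> R r c d}
    = (\<Sum>r = 1..m. pairsum (\<lambda>c d. of_bool (R r c d)) [1..<Suc n])"
proof -
  let ?P = "{(c, d). c \<in> set [1..<Suc n] \<and> d \<in> set [1..<Suc n] \<and> c < d}"
  have fin: "finite ?P"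
    by (rule finite_subset[of _ "{1..n} \<times> {1..n}"]) auto
  have Sigma: "{(r, c, d). r \<in> {1..m} \<and> 1 \<le> c \<and> c < d \<and> d \<le> n \<and> R r c d}
      = (SIGMA r:{1..m}. ?P \<inter> {(c, d). R r c d})"
    by auto
  have card: "card (?P \<inter> {(c, d). R r c d}) = pairsum (\<lambda>c d. of_bool (R r c d)) [1..<Suc n]" for r
    using fin
    by (simp add: pairsum_sorted[OF sorted_wrt_upt] case_prod_unfold del: upt_Suc set_upt)
  have "card (SIGMA r:{1..m}. ?P \<inter> {(c, d). R r c d}) = (\<Sum>r = 1..m. card (?P \<inter> {(c, d). R r c d}))"
    using fin by (intro card_SigmaI) auto
  then show ?thesis
    unfolding Sigma card .
qed

locale rectangle =
  fixes lam :: "nat list" and n :: nat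
  assumes diagram: "diagram lam = {1..length lam} \<times> {1..n}"
begin

lemma col_height: "col_height lam c = (if c \<in> {1..n} then length lam else 0)"
proof -
  have "{r. (r, c) \<in> diagram lam} = (if c \<in> {1..n} then {1..length lam} else {})"
    unfolding diagram by auto
  then show ?thesis unfolding col_height_def by simp
qed

lemma fillings:
  "fillings lam = {\<sigma>. \<forall>r c. if r \<in> {1..length lam} \<and> c \<in> {1..n} then 0 < \<sigma> r c else \<sigma> r c = 0}"
  unfolding fillings_def diagram by (auto split: if_splits)

lemma row_equivalentI:
  assumes "\<And>r. \<exists>p. p permutes {1..n} \<and> \<tau> r = \<sigma> r \<circ> p"
  shows "row_equivalent lam \<tau> \<sigma>"
  unfolding row_equivalent_def row_entries_def
proof
  fix r assume r: "r \<in> {1..length lam}"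
  then have "{c. (r, c) \<in> diagram lam} = {1..n}" by (auto simp: diagram)
  moreover obtain p where "p permutes {1..n}" "\<tau> r = \<sigma> r \<circ> p" using assms by blast
  ultimately show "image_mset (\<tau> r) (mset_set {c. (r, c) \<in> diagram lam})
      = image_mset (\<sigma> r) (mset_set {c. (r, c) \<in> diagram lam})"
    using image_mset_permutes by metis
qed

text \<open>As all columns have the same height, the weight of a descent depends only on its row,
  and \<open>maj\<close> is determined by the descent numbers of the rows.\<close>

lemma maj_eq:
  "maj lam \<sigma> = (\<Sum>r = 2..length lam. (length lam - r + 1) * row_des {1..n} (\<sigma> r) (\<sigma> (r - 1)))"
proof -
  have "descents lam \<sigma> = (SIGMA r:{2..length lam}. {c \<in> {1..n}. \<sigma> (r - 1) c < \<sigma> r c})"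
    unfolding descents_def diagram by auto
  then have "maj lam \<sigma> = (\<Sum>r = 2..length lam. \<Sum>c | c \<in> {1..n} \<and> \<sigma> (r - 1) c < \<sigma> r c. col_height lam c - r + 1)"
    unfolding maj_def by (simp add: sum.Sigma)
  also have "\<dots> = (\<Sum>r = 2..length lam. (length lam - r + 1) * row_des {1..n} (\<sigma> r) (\<sigma> (r - 1)))"
    by (simp add: row_des_eq_card col_height mult.commute)
  finally show ?thesis .
qed

lemma quinv_eq: "quinv lam \<sigma> = (\<Sum>r = 1..length lam. row_quinv (\<sigma> (r + 1)) (\<sigma> r) [1..<Suc n])"
proof -
  have "quinv_triples lam \<sigma> = {(r, c, d). r \<in> {1..length lam} \<and> 1 \<le> c \<and> c < d \<and> d \<le> n \<and>
      Q (\<sigma> (r + 1) c) (\<sigma> r c) (\<sigma> r d)}"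
    unfolding quinv_triples_def col_height by (auto split: if_splits)
  then show ?thesis
    unfolding quinv_def row_quinv_def by (simp only: card_pairs)
qed

lemma eta_eq: "eta S lam \<sigma> = (\<Sum>r = 1..length lam.
    pairsum (\<lambda>c d. of_bool (Q_S S (\<sigma> (r + 1) c) (\<sigma> (r + 1) d) (\<sigma> r c) (\<sigma> r d))) [1..<Suc n])"
proof -
  \<comment> \<open>A triple requires \<open>r \<le> col_height lam d\<close> with
    \<open>1 \<le> r\<close>, so both columns lie in the rectangle and have equal height.\<close>
  have "{(r, c, d) \<in> quinv_triples lam \<sigma>. col_height lam d < col_height lam c} = {}"
    unfolding quinv_triples_def col_height by (auto split: if_splits)
  moreover have "{(r, c, d). 1 \<le> c \<and> c < d \<and> col_height lam c = col_height lam d \<and>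
      1 \<le> r \<and> r \<le> col_height lam c \<and> Q_S S (\<sigma> (r + 1) c) (\<sigma> (r + 1) d) (\<sigma> r c) (\<sigma> r d)}
    = {(r, c, d). r \<in> {1..length lam} \<and> 1 \<le> c \<and> c < d \<and> d \<le> n \<and>
      Q_S S (\<sigma> (r + 1) c) (\<sigma> (r + 1) d) (\<sigma> r c) (\<sigma> r d)}"
    unfolding col_height by (auto split: if_splits)
  ultimately show ?thesis
    unfolding eta_def eta_S_def by (simp only: card_pairs card.empty add_0_right)
qed

end

theorem theorem5p1:
  fixes lam :: "nat list" and \<eta> :: "nat list \<Rightarrow> filling \<Rightarrow> nat"
  assumes "is_partition lam" and "is_rectangle lam" and "\<eta> \<in> A_plus"
  shows "\<exists>\<gamma>. bij_betw \<gamma> (fillings lam) (fillings lam) \<and>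
    (\<forall>\<sigma> \<in> fillings lam.
       row_equivalent lam (\<gamma> \<sigma>) \<sigma> \<and>
       maj lam (\<gamma> \<sigma>) = maj lam \<sigma> \<and>
       \<eta> lam (\<gamma> \<sigma>) = quinv lam \<sigma> \<and>
       (\<forall>c \<in> columns lam. \<gamma> \<sigma> (length lam) c = \<sigma> (length lam) c) \<and>
       (\<forall>r \<ge> 1. card {c \<in> columns lam. \<gamma> \<sigma> (r + 1) c > \<gamma> \<sigma> r c} =
                card {c \<in> columns lam. \<sigma> (r + 1) c > \<sigma> r c}))"
proof -
  obtain n where "diagram lam = {1..length lam} \<times> {1..n}"
    using rectangle_diagram assms(1,2) by blast
  then interpret rectangle lam n by unfold_locales
  obtain S d1 d2 d3 where S: "\<eta> = eta S"
    "\<And>w b i j. i < j \<Longrightarrow> Q_S S (w i) (w j) (b i) (b j) = Q3 d1 d2 d3 w b i j"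
    using A_plus_Q3[OF assms(3)] by blast
  define m where "m = length lam"
  let ?L = "[1..<Suc n]"
  let ?g = "\<lambda>w b. pairsum (\<lambda>c d. of_bool (Q_S S (w c) (w d) (b c) (b d))) ?L"
  have g: "?g w b = pairsum (\<lambda>c d. of_bool (Q3 d1 d2 d3 w b c d)) ?L" for w b
    by (rule pairsum_cong_sorted[OF sorted_wrt_upt]) (simp add: S(2))
  have L: "distinct ?L" "set ?L = {1..n}" by auto
  have "equidist {1..n} w (\<lambda>b. row_quinv w b ?L) w' (?g w')"
    if "image_mset w (mset_set {1..n}) = image_mset w' (mset_set {1..n})" for w w'
    unfolding g using that L by (rule equidist_qsum_Q3)
  then obtain \<gamma> where bij: "bij_betw \<gamma> (fillings lam) (fillings lam)"
    and \<gamma>: "\<forall>\<sigma>\<in>fillings lam. (\<forall>r. \<exists>p. p permutes {1..n} \<and> \<gamma> \<sigma> r = \<sigma> r \<circ> p) \<and>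
      (\<forall>r\<ge>m. \<gamma> \<sigma> r = \<sigma> r) \<and>
      (\<forall>r. 1 \<le> r \<and> r < m \<longrightarrow>
         row_des {1..n} (\<gamma> \<sigma> (r + 1)) (\<gamma> \<sigma> r) = row_des {1..n} (\<sigma> (r + 1)) (\<sigma> r) \<and>
         ?g (\<gamma> \<sigma> (r + 1)) (\<gamma> \<sigma> r) = row_quinv (\<sigma> (r + 1)) (\<sigma> r) ?L)"
    using ex_row_bijection[of "{1..n}" "\<lambda>w b. row_quinv w b ?L" ?g m] unfolding fillings m_def by blast
  have "row_equivalent lam (\<gamma> \<sigma>) \<sigma> \<and> maj lam (\<gamma> \<sigma>) = maj lam \<sigma> \<and>
      \<eta> lam (\<gamma> \<sigma>) = quinv lam \<sigma> \<and>
      (\<forall>c \<in> columns lam. \<gamma> \<sigma> (length lam) c = \<sigma> (length lam) c) \<and>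
      (\<forall>r \<ge> 1. card {c \<in> columns lam. \<gamma> \<sigma> (r + 1) c > \<gamma> \<sigma> r c} =
               card {c \<in> columns lam. \<sigma> (r + 1) c > \<sigma> r c})" if \<sigma>: "\<sigma> \<in> fillings lam" for \<sigma>
  proof -
    have perm: "\<exists>p. p permutes {1..n} \<and> \<gamma> \<sigma> r = \<sigma> r \<circ> p" for r
      using \<gamma> \<sigma> by blast
    have top: "\<gamma> \<sigma> r = \<sigma> r" if "m \<le> r" for r
      using \<gamma> \<sigma> that by blast
    have row_des: "row_des {1..n} (\<gamma> \<sigma> (r + 1)) (\<gamma> \<sigma> r) = row_des {1..n} (\<sigma> (r + 1)) (\<sigma> r)" if "1 \<le> r" for r
      using \<gamma> \<sigma> that top by (cases "r < m") auto
    have zero: "\<sigma> (Suc m) = (\<lambda>_. 0)"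
      using \<sigma> by (auto simp: fillings m_def)
    \<comment> \<open>Above row \<open>m\<close> all entries are 0, so every comparison of upper
      entries is a tie and the columns are read in their own order, exactly as for quinv.\<close>
    have "?g (\<sigma> (m + 1)) (\<sigma> m) = row_quinv (\<sigma> (m + 1)) (\<sigma> m) ?L"
      unfolding g row_quinv_def
      by (rule pairsum_cong_sorted[OF sorted_wrt_upt]) (simp add: zero Q3_def Q_dir_def before_def)
    then have stat: "?g (\<gamma> \<sigma> (r + 1)) (\<gamma> \<sigma> r) = row_quinv (\<sigma> (r + 1)) (\<sigma> r) ?L" if "r \<in> {1..m}" for r
      using \<gamma> \<sigma> that top by (cases "r = m") auto
    have "row_equivalent lam (\<gamma> \<sigma>) \<sigma>"
      using perm by (rule row_equivalentI)
    moreover have "maj lam (\<gamma> \<sigma>) = maj lam \<sigma>"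
      unfolding maj_eq
    proof (rule sum.cong)
      fix r assume "r \<in> {2..length lam}"
      then have "1 \<le> r - 1" "r - 1 + 1 = r" by auto
      then show "(length lam - r + 1) * row_des {1..n} (\<gamma> \<sigma> r) (\<gamma> \<sigma> (r - 1))
          = (length lam - r + 1) * row_des {1..n} (\<sigma> r) (\<sigma> (r - 1))"
        using row_des[of "r - 1"] by simp
    qed simp
    moreover have "\<eta> lam (\<gamma> \<sigma>) = quinv lam \<sigma>"
      unfolding S(1) eta_eq quinv_eq using stat by (intro sum.cong) (auto simp: m_def)
    moreover have "card {c \<in> columns lam. \<gamma> \<sigma> (r + 1) c > \<gamma> \<sigma> r c} =
        card {c \<in> columns lam. \<sigma> (r + 1) c > \<sigma> r c}" if "1 \<le> r" for r
    \<comment> \<open>For the empty partition \<open>n\<close> is arbitrary while there are no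
      columns, so \<open>columns lam\<close> need not be \<open>{1..n}\<close>.\<close>
    proof (cases "lam = []")
      case False
      then have "columns lam = {1..n}"
        by (auto simp: columns_def diagram Suc_le_eq)
      then show ?thesis using row_des[OF that] by (simp add: row_des_eq_card)
    next
      case True
      then have "columns lam = {}" unfolding columns_def diagram by auto
      then show ?thesis by simp
    qed
    ultimately show ?thesis
      using top[of "length lam"] by (simp add: m_def)
  qed
  with bij show ?thesis by blast
qed

end
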